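(* Let $n\ge 1$ and let $x=(x_1,\dots,x_n)\in\mathbb{R}^n$ with $x_i>0$ for all $i$. Let $V_n(x)$ be the $n$-dimensional volume of the polytope $$\Pi_n(x)=\{y\in\mathbb{R}^n: y_i\ge 0 \text{ and } y_1+\cdots+y_i\le x_1+\cdots+x_i \text{ for all } 1\le i\le n\}.$$ Then $$V_n(x)=\sum_{k\in K_n}\ \prod_{i=1}^n \frac{x_i^{k_i}}{k_i!}=\frac{1}{n!}\sum_{k\in K_n}\binom{n}{k_1,\dots,k_n}x_1^{k_1}\cdots x_n^{k_n},$$ where $$K_n=\Big\{k=(k_1,\dots,k_n)\in\mathbb{N}^n:\ \sum_{i=1}^j k_i\ge j \text{ for all } 1\le j\le n-1,\ \text{ and } \sum_{i=1}^n k_i=n\Big\}.$$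
   Context: $\mathbb{N}=\{0,1,2,\dots\}$. *)

theory Defs
  imports "HOL-Analysis.Analysis"
begin

text \<open>
  Vectors indexed by \<open>1, \<dots>, n\<close> are functions on \<open>nat\<close> that are undefined outside
  \<open>{1..n}\<close>; \<open>n\<close>-dimensional volume is the product of \<open>n\<close> copies of one-dimensional Lebesgue
  measure, as in \<open>HOL-Analysis.Simplex_Content\<close>.
\<close>

definition Pi_polytope :: "nat \<Rightarrow> (nat \<Rightarrow> real) \<Rightarrow> (nat \<Rightarrow> real) set" where
  "Pi_polytope n x =
     {y \<in> {1..n} \<rightarrow>\<^sub>E UNIV.
        \<forall>i\<in>{1..n}. 0 \<le> y i \<and> (\<Sum>j=1..i. y j) \<le> (\<Sum>j=1..i. x j)}"

definition vol :: "nat \<Rightarrow> (nat \<Rightarrow> real) set \<Rightarrow> real" where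
  "vol n S = measure (\<Pi>\<^sub>M i\<in>{1..n}. lborel) S"

definition V :: "nat \<Rightarrow> (nat \<Rightarrow> real) \<Rightarrow> real" where
  "V n x = vol n (Pi_polytope n x)"

definition K :: "nat \<Rightarrow> (nat \<Rightarrow> nat) set" where
  "K n = {k \<in> {1..n} \<rightarrow>\<^sub>E UNIV.
            (\<forall>j\<in>{1..<n}. j \<le> (\<Sum>i=1..j. k i)) \<and> (\<Sum>i=1..n. k i) = n}"

text \<open>Only meaningful when \<open>k 1 + \<dots> + k n = n\<close>, and then the division is exact.\<close>

definition multinomial :: "nat \<Rightarrow> (nat \<Rightarrow> nat) \<Rightarrow> nat" where
  "multinomial n k = fact n div (\<Prod>i=1..n. fact (k i))"

text \<open>
  \<open>sum\<close> is \<open>0\<close> on infinite sets, and \<open>measure\<close> is \<open>0\<close> on sets that are not measurable or have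
  infinite measure; neither default value occurs here.
\<close>

lemma finite_K: "finite (K n)"
proof (rule finite_subset)
  show "K n \<subseteq> {1..n} \<rightarrow>\<^sub>E {..n}"
  proof
    fix k assume k: "k \<in> K n"
    have "k i \<le> n" if "i \<in> {1..n}" for i
      using k member_le_sum[of i "{1..n}" k] that by (auto simp: K_def)
    then show "k \<in> {1..n} \<rightarrow>\<^sub>E {..n}"
      using k by (auto simp: K_def PiE_iff)
  qed
qed (simp add: finite_PiE)

lemma sets_Pi_polytope: "Pi_polytope n x \<in> sets (\<Pi>\<^sub>M i\<in>{1..n}. lborel)"
proof -
  let ?M = "\<Pi>\<^sub>M i\<in>{1..n}. (lborel :: real measure)"
  have comp: "(\<lambda>y. y i) \<in> borel_measurable ?M" if "i \<in> {1..n}" for i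
    using measurable_component_singleton[OF that, of "\<lambda>_. lborel :: real measure"] by simp
  have sums: "(\<lambda>y. \<Sum>j=1..i. y j) \<in> borel_measurable ?M" if "i \<in> {1..n}" for i
    using that by (intro borel_measurable_sum comp) auto
  have "Pi_polytope n x = {y \<in> space ?M.
          \<forall>i\<in>{1..n}. 0 \<le> y i \<and> (\<Sum>j=1..i. y j) \<le> (\<Sum>j=1..i. x j)}"
    by (simp add: Pi_polytope_def space_PiM)
  also have "\<dots> \<in> sets ?M"
    by (intro sets.sets_Collect_finite_All sets.sets_Collect_conj borel_measurable_le
          comp sums borel_measurable_const) auto
  finally show ?thesis .
qed

lemma emeasure_Pi_polytope_finite:
  "emeasure (\<Pi>\<^sub>M i\<in>{1..n}. lborel) (Pi_polytope n x) < \<infinity>"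
proof -
  interpret product_sigma_finite "\<lambda>_::nat. lborel :: real measure" ..
  let ?M = "\<Pi>\<^sub>M i\<in>{1..n}. (lborel :: real measure)"
  let ?B = "\<Pi>\<^sub>E i\<in>{1..n}. {0..\<Sum>j=1..i. x j}"
  have "Pi_polytope n x \<subseteq> ?B"
  proof
    fix y assume y: "y \<in> Pi_polytope n x"
    have "y i \<le> (\<Sum>j=1..i. x j)" if "i \<in> {1..n}" for i
    proof -
      have "y i \<le> (\<Sum>j=1..i. y j)"
        using y that by (intro member_le_sum) (auto simp: Pi_polytope_def)
      then show ?thesis using y that by (force simp: Pi_polytope_def)
    qed
    then show "y \<in> ?B" using y by (auto simp: Pi_polytope_def PiE_iff)
  qed
  then have "emeasure ?M (Pi_polytope n x) \<le> emeasure ?M ?B"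
    by (intro emeasure_mono sets_PiM_I_finite) auto
  also have "\<dots> = (\<Prod>i\<in>{1..n}. emeasure lborel {0..\<Sum>j=1..i. x j})"
    by (intro emeasure_PiM) auto
  also have "\<dots> < \<infinity>"
    by (simp add: ennreal_prod_eq_top less_top[symmetric] emeasure_lborel_Icc_eq)
  finally show ?thesis .
qed

end

theory Submission
  imports Defs
begin

text \<open>
  Let \<open>s = (x\<^sub>1 + \<dots> + x\<^sub>n) - (y\<^sub>1 + \<dots> + y\<^sub>n)\<close> be the slack of the last constraint, and let
  \<open>F n m\<close> be the integral of \<open>s ^ m / m!\<close> over the polytope, so that \<open>V n = F n 0\<close>. Integrating
  out the last coordinate turns \<open>s ^ m / m!\<close> into \<open>(s + x\<^sub>n) ^ (m + 1) / (m + 1)!\<close>, where \<open>s\<close> is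
  now the slack in dimension \<open>n - 1\<close>; the binomial theorem then yields
  \<open>F n m = (\<Sum>j\<le>m + 1. x\<^sub>n ^ j / j! * F (n - 1) (m + 1 - j))\<close>. The sum over the sequences
  whose \<open>i\<close>-th partial sum is at least \<open>i\<close> for all \<open>i \<le> n\<close> and whose total is \<open>n + m\<close>
  satisfies the same recursion, by splitting off the last entry.
\<close>

text \<open>The excess \<open>m\<close> of the total over \<open>n\<close> is a parameter because
  cutting off the last entry changes it. It corresponds to the exponent of the slack in the
  integral.\<close>

definition excess_seqs :: "nat \<Rightarrow> nat \<Rightarrow> (nat \<Rightarrow> nat) set" where
  "excess_seqs n m = {k \<in> {1..n} \<rightarrow>\<^sub>E UNIV.
     (\<forall>j\<in>{1..n}. j \<le> (\<Sum>i=1..j. k i)) \<and> (\<Sum>i=1..n. k i) = n + m}"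

lemma excess_seqs_0: "excess_seqs 0 m = (if m = 0 then {\<lambda>_. undefined} else {})"
  by (auto simp: excess_seqs_def)

text \<open>The two definitions differ only in the bound at \<open>j = n\<close>, which holds with
  equality once the total is \<open>n\<close>.\<close>

lemma K_eq_excess_seqs: "K n = excess_seqs n 0"
proof -
  have "(\<forall>j\<in>{1..<n}. j \<le> (\<Sum>i=1..j. k i)) \<longleftrightarrow> (\<forall>j\<in>{1..n}. j \<le> (\<Sum>i=1..j. k i))"
    if "(\<Sum>i=1..n. k i) = n" for k :: "nat \<Rightarrow> nat"
    using that by (metis atLeastAtMost_iff atLeastLessThan_iff le_neq_implies_less
        less_imp_le order_refl)
  then show ?thesis
    by (auto simp: K_def excess_seqs_def)
qed

lemma finite_excess_seqs: "finite (excess_seqs n m)"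
proof (rule finite_subset)
  show "excess_seqs n m \<subseteq> {1..n} \<rightarrow>\<^sub>E {..n + m}"
  proof
    fix k assume k: "k \<in> excess_seqs n m"
    have "k i \<le> n + m" if "i \<in> {1..n}" for i
      using k member_le_sum[of i "{1..n}" k] that by (auto simp: excess_seqs_def)
    then show "k \<in> {1..n} \<rightarrow>\<^sub>E {..n + m}"
      using k by (auto simp: excess_seqs_def PiE_iff)
  qed
qed (simp add: finite_PiE)

definition excess_sum :: "nat \<Rightarrow> nat \<Rightarrow> (nat \<Rightarrow> real) \<Rightarrow> real" where
  "excess_sum n m x = (\<Sum>k\<in>excess_seqs n m. \<Prod>i=1..n. x i ^ k i / fact (k i))"

lemma excess_sum_nonneg:
  assumes "\<And>i. i \<in> {1..n} \<Longrightarrow> 0 \<le> x i"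
  shows "0 \<le> excess_sum n m x"
  unfolding excess_sum_def using assms by (intro sum_nonneg prod_nonneg) auto

text \<open>Group the sequences by their last entry \<open>j\<close>: the first \<open>n\<close>
  entries have total \<open>n + (Suc m - j)\<close>, so they form a member of
  \<open>excess_seqs n (Suc m - j)\<close>.\<close>

lemma excess_sum_Suc:
  "excess_sum (Suc n) m x =
     (\<Sum>j\<le>Suc m. x (Suc n) ^ j / fact j * excess_sum n (Suc m - j) x)"
proof -
  let ?w = "\<lambda>n k. \<Prod>i=1..n. x i ^ k i / fact (k i)"
  let ?S = "SIGMA j:{..Suc m}. excess_seqs n (Suc m - j)"
  have sum_upd: "(\<Sum>i=1..j. (k(Suc n := a)) i) = (\<Sum>i=1..j. k i)"
    if "j \<le> n" for j a and k :: "nat \<Rightarrow> nat"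
    using that by (intro sum.cong) auto
  have prod_upd: "?w n (k(Suc n := a)) = ?w n k" for a and k :: "nat \<Rightarrow> nat"
    by (intro prod.cong) auto
  have "(\<Sum>j\<le>Suc m. x (Suc n) ^ j / fact j * excess_sum n (Suc m - j) x)
      = (\<Sum>(j, k)\<in>?S. x (Suc n) ^ j / fact j * ?w n k)"
    unfolding excess_sum_def sum_distrib_left
    by (rule sum.Sigma) (auto simp: finite_excess_seqs)
  also have "\<dots> = (\<Sum>k\<in>excess_seqs (Suc n) m. ?w (Suc n) k)"
  proof (rule sum.reindex_bij_witness[where j = "\<lambda>(j, k). k(Suc n := j)"
        and i = "\<lambda>k. (k (Suc n), k(Suc n := undefined))"])
    fix p assume p: "p \<in> ?S"
    obtain j k where jk: "p = (j, k)" "j \<le> Suc m" "k \<in> excess_seqs n (Suc m - j)"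
      using p by auto
    \<comment> \<open>Extensionality is what lets resetting position \<open>Suc n\<close> to
      \<open>undefined\<close> undo the appending of \<open>j\<close>.\<close>
    have "k (Suc n) = undefined"
      using jk by (auto simp: excess_seqs_def PiE_def extensional_def)
    then show "(\<lambda>k. (k (Suc n), k(Suc n := undefined))) ((\<lambda>(j, k). k(Suc n := j)) p) = p"
      using jk by (auto simp: fun_eq_iff)
    show "(\<lambda>(j, k). k(Suc n := j)) p \<in> excess_seqs (Suc n) m"
      using jk by (auto simp: excess_seqs_def sum_upd PiE_iff extensional_def le_Suc_eq)
    show "?w (Suc n) ((\<lambda>(j, k). k(Suc n := j)) p) =
        (\<lambda>(j, k). x (Suc n) ^ j / fact j * ?w n k) p"
      using jk prod_upd by (simp add: mult.commute)
  next
    fix k assume k: "k \<in> excess_seqs (Suc n) m"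
    show "(\<lambda>(j, k). k(Suc n := j)) (k (Suc n), k(Suc n := undefined)) = k"
      by simp
    have tot: "(\<Sum>i=1..n. k i) + k (Suc n) = Suc n + m"
      using k by (simp add: excess_seqs_def)
    have part: "j \<le> (\<Sum>i=1..j. k i)" if "j \<le> n" for j
      using k that by (cases "j = 0") (auto simp: excess_seqs_def)
    \<comment> \<open>The bound on the partial sum at \<open>n\<close> limits the last entry, so the
      subtraction \<open>Suc m - k (Suc n)\<close> on naturals is exact.\<close>
    have "k (Suc n) \<le> Suc m"
      using tot part[of n] by simp
    moreover have "(\<Sum>i=1..n. k i) = n + (Suc m - k (Suc n))"
      using tot part[of n] by simp
    moreover have "k(Suc n := undefined) \<in> {1..n} \<rightarrow>\<^sub>E UNIV"
      using k by (auto simp: excess_seqs_def PiE_iff extensional_def)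
    ultimately show "(k (Suc n), k(Suc n := undefined)) \<in> ?S"
      using part by (auto simp: excess_seqs_def sum_upd)
  qed
  finally show ?thesis
    by (simp add: excess_sum_def)
qed

text \<open>The binomial theorem for the divided powers \<open>a ^ m / fact m\<close>, read off from
  the coefficient identity behind \<open>exp (a + b) = exp a * exp b\<close>.\<close>

lemma power_add_over_fact:
  fixes a b :: real
  shows "(a + b) ^ m / fact m = (\<Sum>j\<le>m. b ^ j / fact j * (a ^ (m - j) / fact (m - j)))"
  using exp_series_add_commuting[of b a m] by (simp add: divide_inverse_commute add.commute)

lemma nn_integral_power_Icc:
  fixes a :: real
  assumes "0 \<le> a"
  shows "(\<integral>\<^sup>+t. ennreal ((a - t) ^ m / fact m) * indicator {0..a} t \<partial>lborel)
    = ennreal (a ^ Suc m / fact (Suc m))"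
proof -
  let ?F = "\<lambda>t. - ((a - t) ^ Suc m / fact (Suc m))"
  have "(\<integral>\<^sup>+t. ennreal ((a - t) ^ m / fact m) * indicator {0..a} t \<partial>lborel)
      = ennreal (?F a - ?F 0)"
  proof (rule nn_integral_FTC_Icc)
    fix t :: real
    show "DERIV ?F t :> (a - t) ^ m / fact m"
      by (auto intro!: derivative_eq_intros simp del: power_Suc simp: divide_simps)
  qed (use assms in auto)
  then show ?thesis by simp
qed

text \<open>The first \<open>n\<close> constraints do not involve \<open>t\<close>; the last one
  bounds \<open>t\<close> by the old slack plus \<open>x (Suc n)\<close>.\<close>

lemma Pi_polytope_Suc:
  assumes "y \<in> {1..n} \<rightarrow>\<^sub>E UNIV"
  shows "y(Suc n := t) \<in> Pi_polytope (Suc n) x \<longleftrightarrow>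
    y \<in> Pi_polytope n x \<and> t \<in> {0..(\<Sum>i=1..n. x i - y i) + x (Suc n)}"
proof -
  have upd: "(\<Sum>i=1..j. (y(Suc n := t)) i) = (\<Sum>i=1..j. y i)" if "j \<le> n" for j
    using that by (intro sum.cong) auto
  have "y(Suc n := t) \<in> {1..Suc n} \<rightarrow>\<^sub>E UNIV"
    using assms by (auto simp: PiE_iff extensional_def)
  then show ?thesis
    using assms upd
    by (auto simp: Pi_polytope_def atLeastAtMostSuc_conv sum_subtractf)
qed

text \<open>Induction on \<open>n\<close> with \<open>m\<close> arbitrary, since the step uses all
  exponents up to \<open>Suc m\<close>. The slack is nonnegative on the polytope, so
  \<open>ennreal\<close> truncates nothing where the indicator is nonzero.\<close>

lemma nn_integral_slack_power:
  assumes "\<And>i. i \<in> {1..n} \<Longrightarrow> 0 \<le> x i"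
  shows "(\<integral>\<^sup>+y. ennreal ((\<Sum>i=1..n. x i - y i) ^ m / fact m) * indicator (Pi_polytope n x) y
            \<partial>(\<Pi>\<^sub>M i\<in>{1..n}. lborel)) = ennreal (excess_sum n m x)"
  using assms
proof (induction n arbitrary: m)
  case 0
  \<comment> \<open>The empty product measure is a unit point mass and the slack is
    \<open>0\<close>; by \<open>0 ^ 0 = 1\<close> the integral is \<open>1\<close> for
    \<open>m = 0\<close> and \<open>0\<close> otherwise, as in \<open>excess_seqs_0\<close>.\<close>
  have "Pi_polytope 0 x = {\<lambda>_. undefined}"
    by (auto simp: Pi_polytope_def)
  then show ?case
    by (simp add: PiM_empty nn_integral_count_space_finite excess_sum_def excess_seqs_0 power_0_left)
next
  case (Suc n)
  interpret product_sigma_finite "\<lambda>_::nat. lborel :: real measure" ..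
  let ?M = "\<Pi>\<^sub>M i\<in>{1..n}. (lborel :: real measure)"
  let ?s = "\<lambda>n y. \<Sum>i=1..n. x i - y i"
  let ?I = "\<lambda>n. indicator (Pi_polytope n x) :: _ \<Rightarrow> ennreal"
  have meas: "(\<lambda>y. ennreal (?s n y ^ m / fact m) * ?I n y)
      \<in> borel_measurable (\<Pi>\<^sub>M i\<in>{1..n}. (lborel :: real measure))" for n m
  proof -
    have "(\<lambda>y. y i) \<in> borel_measurable (\<Pi>\<^sub>M i\<in>{1..n}. (lborel :: real measure))"
      if "i \<in> {1..n}" for i
      using measurable_component_singleton[OF that, of "\<lambda>_. lborel :: real measure"] by simp
    moreover note sets_Pi_polytope[of n x]
    ultimately show ?thesis by measurable
  qed
  have s_nonneg: "0 \<le> ?s n y" if "y \<in> Pi_polytope n x" for y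
  proof (cases "n = 0")
    case False
    then show ?thesis using that by (auto simp: Pi_polytope_def sum_subtractf)
  qed simp
  \<comment> \<open>The integral over the last coordinate for fixed \<open>y\<close>. Outside the
    polytope both sides vanish, as no \<open>t\<close> extends \<open>y\<close> to a point of the
    larger polytope.\<close>
  have inner: "(\<integral>\<^sup>+t. ennreal (?s (Suc n) (y(Suc n := t)) ^ m / fact m) *
        ?I (Suc n) (y(Suc n := t)) \<partial>lborel)
      = (\<Sum>j\<le>Suc m. ennreal (x (Suc n) ^ j / fact j) *
           (ennreal (?s n y ^ (Suc m - j) / fact (Suc m - j)) * ?I n y))"
    if y: "y \<in> space ?M" for y
  proof (cases "y \<in> Pi_polytope n x")
    case True
    let ?a = "?s n y + x (Suc n)"
    have a: "0 \<le> ?a" using s_nonneg[OF True] Suc.prems[of "Suc n"] by simp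
    have "?s n (y(Suc n := t)) = ?s n y" for t
      by (intro sum.cong) auto
    then have slack: "?s (Suc n) (y(Suc n := t)) = ?a - t" for t
      by simp
    have ind: "?I (Suc n) (y(Suc n := t)) = indicator {0..?a} t" for t
      using y True by (simp add: space_PiM Pi_polytope_Suc indicator_def)
    have "(\<integral>\<^sup>+t. ennreal (?s (Suc n) (y(Suc n := t)) ^ m / fact m) *
        ?I (Suc n) (y(Suc n := t)) \<partial>lborel) = ennreal (?a ^ Suc m / fact (Suc m))"
      unfolding slack ind by (rule nn_integral_power_Icc[OF a])
    also have "\<dots> = (\<Sum>j\<le>Suc m. ennreal (x (Suc n) ^ j / fact j *
        (?s n y ^ (Suc m - j) / fact (Suc m - j))))"
      unfolding power_add_over_fact using s_nonneg[OF True] Suc.prems[of "Suc n"]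
      by (intro sum_ennreal[symmetric]) (auto intro!: mult_nonneg_nonneg divide_nonneg_pos)
    also have "\<dots> = (\<Sum>j\<le>Suc m. ennreal (x (Suc n) ^ j / fact j) *
           (ennreal (?s n y ^ (Suc m - j) / fact (Suc m - j)) * ?I n y))"
      using True s_nonneg[OF True] Suc.prems[of "Suc n"]
      by (intro sum.cong) (auto simp: ennreal_mult[symmetric])
    finally show ?thesis .
  next
    case False
    then have "?I (Suc n) (y(Suc n := t)) = 0" for t
      using y by (simp add: space_PiM Pi_polytope_Suc)
    then show ?thesis using False by simp
  qed
  have insert_Icc: "{1..Suc n} = insert (Suc n) {1..n}"
    by auto
  \<comment> \<open>Tonelli, with the last coordinate as the inner integral.\<close>
  have "(\<integral>\<^sup>+y. ennreal (?s (Suc n) y ^ m / fact m) * ?I (Suc n) y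
          \<partial>(\<Pi>\<^sub>M i\<in>{1..Suc n}. lborel))
      = (\<integral>\<^sup>+y. (\<integral>\<^sup>+t. ennreal (?s (Suc n) (y(Suc n := t)) ^ m / fact m) *
          ?I (Suc n) (y(Suc n := t)) \<partial>lborel) \<partial>?M)"
    by (rule product_nn_integral_insert[of "{1..n}" "Suc n", folded insert_Icc, OF _ _ meas]) auto
  also have "\<dots> = (\<integral>\<^sup>+y. (\<Sum>j\<le>Suc m. ennreal (x (Suc n) ^ j / fact j) *
           (ennreal (?s n y ^ (Suc m - j) / fact (Suc m - j)) * ?I n y)) \<partial>?M)"
    by (intro nn_integral_cong inner)
  also have "\<dots> = (\<Sum>j\<le>Suc m. ennreal (x (Suc n) ^ j / fact j) *
      ennreal (excess_sum n (Suc m - j) x))"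
  proof (subst nn_integral_sum)
    show "(\<lambda>y. ennreal (x (Suc n) ^ j / fact j) *
        (ennreal (?s n y ^ (Suc m - j) / fact (Suc m - j)) * ?I n y)) \<in> borel_measurable ?M"
      for j
      by (intro borel_measurable_times_ennreal borel_measurable_const meas)
    show "(\<Sum>j\<le>Suc m. \<integral>\<^sup>+y. ennreal (x (Suc n) ^ j / fact j) *
          (ennreal (?s n y ^ (Suc m - j) / fact (Suc m - j)) * ?I n y) \<partial>?M)
        = (\<Sum>j\<le>Suc m. ennreal (x (Suc n) ^ j / fact j) *
            ennreal (excess_sum n (Suc m - j) x))"
      by (intro sum.cong refl, subst nn_integral_cmult[OF meas], subst Suc.IH)
        (use Suc.prems in auto)
  qed
  also have "\<dots> = ennreal (excess_sum (Suc n) m x)"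
    unfolding excess_sum_Suc using Suc.prems excess_sum_nonneg[of n x]
    by (subst sum_ennreal[symmetric]) (auto simp: ennreal_mult[symmetric] simp del: sum.atMost_Suc)
  finally show ?case .
qed

lemma V_eq_excess_sum:
  assumes "\<And>i. i \<in> {1..n} \<Longrightarrow> 0 \<le> x i"
  shows "V n x = excess_sum n 0 x"
proof -
  \<comment> \<open>For \<open>m = 0\<close> the integrand is just the indicator of the
    polytope.\<close>
  have "emeasure (\<Pi>\<^sub>M i\<in>{1..n}. lborel) (Pi_polytope n x) = ennreal (excess_sum n 0 x)"
    using nn_integral_slack_power[of n x 0] assms sets_Pi_polytope[of n x] by simp
  then show ?thesis
    using excess_sum_nonneg[OF assms] by (simp add: V_def vol_def measure_def)
qed

text \<open>Splitting off one element at a time reduces this to the integrality of binomial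
  coefficients. It makes the \<open>div\<close> in \<open>multinomial\<close> exact.\<close>

lemma prod_fact_dvd_fact_sum:
  "finite A \<Longrightarrow> (\<Prod>i\<in>A. fact (k i)) dvd (fact (\<Sum>i\<in>A. k i) :: nat)"
proof (induction A rule: finite_induct)
  case (insert a A)
  then have "fact (k a) * (\<Prod>i\<in>A. fact (k i)) dvd (fact (k a) * fact (\<Sum>i\<in>A. k i) :: nat)"
    by simp
  also have "\<dots> dvd fact (k a + (\<Sum>i\<in>A. k i))"
    by (rule fact_fact_dvd_fact)
  finally show ?case using insert by simp
qed simp

lemma real_multinomial:
  assumes "(\<Sum>i=1..n. k i) = n"
  shows "real (multinomial n k) = fact n / (\<Prod>i=1..n. fact (k i))"
  using prod_fact_dvd_fact_sum[of "{1..n}" k] assms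
  by (simp add: multinomial_def real_of_nat_div)

theorem theorem1:
  fixes n :: nat and x :: "nat \<Rightarrow> real"
  assumes "n \<ge> 1"
    and "\<And>i. i \<in> {1..n} \<Longrightarrow> x i > 0"
  shows "V n x = (\<Sum>k\<in>K n. \<Prod>i=1..n. x i ^ k i / fact (k i)) \<and>
         (\<Sum>k\<in>K n. \<Prod>i=1..n. x i ^ k i / fact (k i)) =
         1 / fact n * (\<Sum>k\<in>K n. real (multinomial n k) * (\<Prod>i=1..n. x i ^ k i))"
proof
  show "V n x = (\<Sum>k\<in>K n. \<Prod>i=1..n. x i ^ k i / fact (k i))"
    using V_eq_excess_sum[of n x] assms(2)
    by (simp add: K_eq_excess_seqs excess_sum_def less_imp_le)
  show "(\<Sum>k\<in>K n. \<Prod>i=1..n. x i ^ k i / fact (k i)) =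
      1 / fact n * (\<Sum>k\<in>K n. real (multinomial n k) * (\<Prod>i=1..n. x i ^ k i))"
    unfolding sum_distrib_left
    by (intro sum.cong) (auto simp: K_def real_multinomial prod_dividef)
qed

end
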